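(* Let $(\mathcal{Z},d_{\mathcal{Z}})$ be a compact metric space, let $\mathcal{M}_1(\mathcal{Z})$ be the set of Borel probability measures on $\mathcal{Z}$ equipped with the bounded Lipschitz metric $d_{\mathrm{BL}}$, let $(\mathcal{W},d_{\mathcal{W}})$ be a complete separable metric space, and let $S:\mathcal{M}_1(\mathcal{Z})\to\mathcal{W}$ be continuous. Let $S_n(z_1,\ldots,z_n):=S\bigl(\frac1n\sum_{i=1}^n\delta_{z_i}\bigr)$ for $n\in\mathbb{N}$ and $z_1,\dots,z_n\in\mathcal{Z}$. Then the sequence $\mathfrak{L}_n(S;P_n)$, $n\in\mathbb{N}$, of bootstrap approximations of $\mathfrak{L}_n(S;P)$ is qualitatively robust at every $P\in\mathcal{M}_1(\mathcal{Z})$.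
   Context: Bounded Lipschitz metric: for a metric space $(\mathcal{S},d)$ and $f:\mathcal{S}\to\mathbb{R}$ let $\|f\|_{\mathrm{BL}}:=\sup_{x}|f(x)|+\sup_{x\neq y}\frac{|f(x)-f(y)|}{d(x,y)}$. For Borel probability measures $\nu,\nu'$ on $\mathcal{S}$, $d_{\mathrm{BL}}(\nu,\nu'):=\sup_{\|f\|_{\mathrm{BL}}\le 1}\bigl|\int f\,d\nu-\int f\,d\nu'\bigr|$. This is used on $\mathcal{M}_1(\mathcal{Z})$ (with $d=d_{\mathcal{Z}}$), on the set $\mathcal{M}_1(\mathcal{W})$ of Borel probability measures on $\mathcal{W}$ (with $d=d_{\mathcal{W}}$), and on the set of Borel probability measures on the metric space $(\mathcal{M}_1(\mathcal{W}),d_{\mathrm{BL}})$. Finite sample distribution: for $P\in\mathcal{M}_1(\mathcal{Z})$, $\mathfrak{L}_n(S;P)\in\mathcal{M}_1(\mathcal{W})$ denotes the distribution of $S_n(Z_1,\ldots,Z_n)$ when $Z_1,\ldots,Z_n$ are i.i.d. with distribution $P$. Bootstrap approximation: for $Q\in\mathcal{M}_1(\mathcal{Z})$ let $Q_n:=\frac1n\sum_{i=1}^n\delta_{Z_i}$ be the (random) empirical measure of $Z_1,\ldots,Z_n$ i.i.d. with distribution $Q$. Then $\mathfrak{L}_n(S;Q_n)$ is a random variable with values in $\mathcal{M}_1(\mathcal{W})$ (the conditional distribution of $S_n$ evaluated at $n$ i.i.d. draws from $Q_n$), and $\mathfrak{L}(\mathfrak{L}_n(S;Q_n))$ denotes its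 distribution, a Borel probability measure on $\mathcal{M}_1(\mathcal{W})$. The sequence of bootstrap approximations $\mathfrak{L}_n(S;P_n)$ is qualitatively robust at $P\in\mathcal{M}_1(\mathcal{Z})$ if for every $\varepsilon>0$ there exist $\delta>0$ and $n_0\in\mathbb{N}$ such that for all $Q\in\mathcal{M}_1(\mathcal{Z})$: $d_{\mathrm{BL}}(Q,P)<\delta$ implies $\sup_{n\ge n_0} d_{\mathrm{BL}}\bigl(\mathfrak{L}(\mathfrak{L}_n(S;Q_n)),\mathfrak{L}(\mathfrak{L}_n(S;P_n))\bigr)<\varepsilon$. *)

theory Defs
  imports "HOL-Probability.Probability"
begin

typedef (overloaded) ('a::topological_space) borel_prob =
    "{M :: 'a measure. prob_space M \<and> sets M = sets borel}"
  morphisms rep_prob Abs_prob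
proof
  show "return borel undefined \<in> {M :: 'a measure. prob_space M \<and> sets M = sets borel}"
    by (auto intro: prob_space_return)
qed

lemma prob_space_rep_prob: "prob_space (rep_prob M)"
  and sets_rep_prob [simp, measurable_cong]: "sets (rep_prob M) = sets borel"
  and space_rep_prob [simp]: "space (rep_prob M) = UNIV"
proof -
  show "prob_space (rep_prob M)" and *: "sets (rep_prob M) = sets borel"
    using rep_prob[of M] by auto
  show "space (rep_prob M) = UNIV"
    using sets_eq_imp_space_eq[OF *] by simp
qed

text \<open>Values in \<^typ>\<open>ennreal\<close>, so that the norm of a function that is not bounded or not Lipschitz
  is infinite, and the supremum over an empty set of pairs is 0.\<close>

definition bl_norm :: "('a::metric_space \<Rightarrow> real) \<Rightarrow> ennreal" where
  "bl_norm f = (SUP x. ennreal \<bar>f x\<bar>) +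
     (SUP (x, y)\<in>{(x, y). x \<noteq> y}. ennreal (\<bar>f x - f y\<bar> / dist x y))"

lemma bl_norm_le_1D:
  assumes "bl_norm f \<le> 1"
  shows "\<bar>f x\<bar> \<le> 1" "\<bar>f x - f y\<bar> \<le> dist x y"
proof -
  have "ennreal \<bar>f x\<bar> \<le> (SUP x. ennreal \<bar>f x\<bar>)"
    by (rule SUP_upper) auto
  also have "\<dots> \<le> bl_norm f"
    unfolding bl_norm_def by simp
  also have "\<dots> \<le> ennreal 1"
    using assms by simp
  finally have "ennreal \<bar>f x\<bar> \<le> ennreal 1" .
  then show "\<bar>f x\<bar> \<le> 1"
    by (simp del: ennreal_1)
  show "\<bar>f x - f y\<bar> \<le> dist x y"
  proof (cases "x = y")
    case False
    then have "ennreal (\<bar>f x - f y\<bar> / dist x y)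
        \<le> (SUP (x, y)\<in>{(x, y). x \<noteq> y}. ennreal (\<bar>f x - f y\<bar> / dist x y))"
      by (intro SUP_upper2[of "(x, y)"]) auto
    also have "\<dots> \<le> bl_norm f"
      unfolding bl_norm_def by simp
    also have "\<dots> \<le> ennreal 1"
      using assms by simp
    finally have "ennreal (\<bar>f x - f y\<bar> / dist x y) \<le> ennreal 1" .
    then show ?thesis
      using False by (simp add: divide_simps del: ennreal_1 split: if_splits)
  qed simp
qed

lemma bl_norm_leI:
  assumes "\<And>x. \<bar>f x\<bar> \<le> a" "\<And>x y. \<bar>f x - f y\<bar> \<le> b * dist x y" "0 \<le> b"
  shows "bl_norm f \<le> ennreal (a + b)"
proof -
  have "0 \<le> a"
    using assms(1)[of undefined] by linarith
  have "(SUP x. ennreal \<bar>f x\<bar>) \<le> ennreal a"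
    by (intro SUP_least ennreal_leI assms)
  moreover have "(SUP (x, y)\<in>{(x, y). x \<noteq> y}. ennreal (\<bar>f x - f y\<bar> / dist x y)) \<le> ennreal b"
    using assms(2) by (auto intro!: SUP_least ennreal_leI simp: divide_simps)
  ultimately show ?thesis
    unfolding bl_norm_def using \<open>0 \<le> a\<close> \<open>0 \<le> b\<close> by (simp add: ennreal_plus add_mono)
qed

lemma bl_norm_measurable:
  assumes "bl_norm f \<le> 1"
  shows "f \<in> borel_measurable borel"
proof -
  have "1-lipschitz_on UNIV f"
    using bl_norm_le_1D(2)[OF assms] by (auto intro!: lipschitz_onI simp: dist_real_def)
  then show ?thesis
    by (intro borel_measurable_continuous_onI lipschitz_on_continuous_on)
qed

lemma bl_norm_integrable:
  assumes "bl_norm f \<le> 1"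
  shows "integrable (rep_prob M) f" "\<bar>integral\<^sup>L (rep_prob M) f\<bar> \<le> 1"
proof -
  interpret prob_space "rep_prob M"
    by (rule prob_space_rep_prob)
  have [measurable]: "f \<in> borel_measurable borel"
    using assms by (rule bl_norm_measurable)
  show int: "integrable (rep_prob M) f"
    using bl_norm_le_1D(1)[OF assms] by (intro integrable_const_bound[of _ 1]) auto
  have "\<bar>integral\<^sup>L (rep_prob M) f\<bar> \<le> (\<integral>x. \<bar>f x\<bar> \<partial>rep_prob M)"
    by (rule integral_abs_bound)
  also have "\<dots> \<le> (\<integral>x. 1 \<partial>rep_prob M)"
    using int bl_norm_le_1D(1)[OF assms] by (intro integral_mono) auto
  finally show "\<bar>integral\<^sup>L (rep_prob M) f\<bar> \<le> 1"
    by (simp add: prob_space[simplified])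
qed

instantiation borel_prob :: (metric_space) metric_space
begin

definition dist_borel_prob :: "'a borel_prob \<Rightarrow> 'a borel_prob \<Rightarrow> real" where
  "dist_borel_prob M N =
     (SUP f\<in>{f. bl_norm f \<le> 1}. \<bar>integral\<^sup>L (rep_prob M) f - integral\<^sup>L (rep_prob N) f\<bar>)"

definition uniformity_borel_prob :: "('a borel_prob \<times> 'a borel_prob) filter" where
  "uniformity_borel_prob = (INF e\<in>{0 <..}. principal {(x, y). dist x y < e})"

definition open_borel_prob :: "'a borel_prob set \<Rightarrow> bool" where
  "open_borel_prob U = (\<forall>x\<in>U. \<forall>\<^sub>F (x', y) in uniformity. x' = x \<longrightarrow> y \<in> U)"

lemma bl_diff_le_2:
  assumes "bl_norm f \<le> 1"
  shows "\<bar>integral\<^sup>L (rep_prob M) f - integral\<^sup>L (rep_prob N) f\<bar> \<le> 2"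
  using bl_norm_integrable(2)[OF assms, of M] bl_norm_integrable(2)[OF assms, of N] by linarith

lemma bl_diff_le_dist:
  assumes "bl_norm f \<le> 1"
  shows "\<bar>integral\<^sup>L (rep_prob M) f - integral\<^sup>L (rep_prob N) f\<bar> \<le> dist M N"
  unfolding dist_borel_prob_def
  using assms by (intro cSUP_upper bdd_aboveI2[of _ _ 2] bl_diff_le_2) auto

lemma dist_borel_prob_leI:
  assumes "\<And>f. bl_norm f \<le> 1 \<Longrightarrow> \<bar>integral\<^sup>L (rep_prob M) f - integral\<^sup>L (rep_prob N) f\<bar> \<le> c"
  shows "dist M N \<le> c"
proof -
  have "bl_norm (\<lambda>_ :: 'a. 0) \<le> 1"
    using bl_norm_leI[of "\<lambda>_ :: 'a. 0" 0 0] by simp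
  then show ?thesis
    unfolding dist_borel_prob_def using assms by (intro cSUP_least) auto
qed

lemma dist_borel_prob_le_2: "dist M N \<le> (2 :: real)" for M N :: "'a borel_prob"
  by (intro dist_borel_prob_leI bl_diff_le_2)

lemma dist_borel_prob_eq_0D:
  fixes M N :: "'a borel_prob"
  assumes "dist M N = 0"
  shows "M = N"
proof -
  interpret M: prob_space "rep_prob M" by (rule prob_space_rep_prob)
  interpret N: prob_space "rep_prob N" by (rule prob_space_rep_prob)
  have closed_eq: "emeasure (rep_prob M) A = emeasure (rep_prob N) A" if "closed A" for A
  proof (cases "A = {}")
    case False
    define g where "g k x = max 0 (1 - real k * infdist x A)" for k x
    have g01: "0 \<le> g k x" "g k x \<le> 1" for k x
      using infdist_nonneg[of x A] by (auto simp: g_def)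
    have lip: "\<bar>g k x - g k y\<bar> \<le> real k * dist x y" for k x y
    proof -
      have "\<bar>g k x - g k y\<bar> \<le> \<bar>real k * infdist x A - real k * infdist y A\<bar>"
        unfolding g_def by linarith
      also have "\<dots> = real k * \<bar>infdist x A - infdist y A\<bar>"
        by (simp add: abs_mult flip: right_diff_distrib)
      also have "\<dots> \<le> real k * dist x y"
        by (intro mult_left_mono infdist_triangle_abs) auto
      finally show ?thesis .
    qed
    have meas [measurable]: "g k \<in> borel_measurable borel" for k
      unfolding g_def by (intro borel_measurable_continuous_onI continuous_intros)
    have g_eq: "integral\<^sup>L (rep_prob M) (g k) = integral\<^sup>L (rep_prob N) (g k)" for k
    proof -
      define h where "h x = g k x / (real k + 1)" for x
      have "\<bar>h x - h y\<bar> \<le> (real k / (real k + 1)) * dist x y" for x y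
        using lip[of k x y] unfolding h_def
        by (simp add: divide_right_mono flip: diff_divide_distrib)
      moreover have "\<bar>h x\<bar> \<le> 1 / (real k + 1)" for x
        using g01[of k x] by (simp add: h_def divide_right_mono)
      ultimately have "bl_norm h \<le> ennreal (1 / (real k + 1) + real k / (real k + 1))"
        by (intro bl_norm_leI) auto
      also have "1 / (real k + 1) + real k / (real k + 1) = 1"
        by (simp add: divide_simps)
      finally have "bl_norm h \<le> 1"
        by simp
      from bl_diff_le_dist[OF this, of M N]
      have "integral\<^sup>L (rep_prob M) h = integral\<^sup>L (rep_prob N) h"
        using assms by simp
      moreover have "g k = (\<lambda>x. (real k + 1) * h x)"
        by (auto simp: h_def)
      ultimately show ?thesis
        by simp
    qed
    have lim: "(\<lambda>k. g k x) \<longlonglongrightarrow> indicator A x" for x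
    proof (cases "x \<in> A")
      case False
      then have pos: "infdist x A > 0"
        using \<open>closed A\<close> \<open>A \<noteq> {}\<close> by (simp add: infdist_pos_not_in_closed)
      obtain k0 :: nat where k0: "real k0 * infdist x A > 1"
        using reals_Archimedean3[OF pos] by blast
      have "g k x = 0" if "k \<ge> k0" for k
      proof -
        have "real k0 * infdist x A \<le> real k * infdist x A"
          using that pos by (intro mult_right_mono) auto
        then show ?thesis
          using k0 unfolding g_def by linarith
      qed
      then have "\<forall>\<^sub>F k in sequentially. g k x = 0"
        by (auto simp: eventually_sequentially)
      then show ?thesis
        using False by (simp add: tendsto_eventually)
    qed (simp add: g_def)
    have *: "(\<lambda>k. integral\<^sup>L (rep_prob R) (g k)) \<longlonglongrightarrow> measure (rep_prob R) A" for R :: "'a borel_prob"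
    proof -
      interpret R: prob_space "rep_prob R" by (rule prob_space_rep_prob)
      have [measurable]: "A \<in> sets borel"
        using that by simp
      have "(\<lambda>k. integral\<^sup>L (rep_prob R) (g k)) \<longlonglongrightarrow> integral\<^sup>L (rep_prob R) (indicator A)"
        by (rule integral_dominated_convergence[where w = "\<lambda>_. 1"]) (use lim g01 in auto)
      then show ?thesis
        using that by simp
    qed
    have "measure (rep_prob M) A = measure (rep_prob N) A"
      using LIMSEQ_unique[OF *[of M] *[of N, folded g_eq]] .
    then show ?thesis
      by (simp add: M.emeasure_eq_measure N.emeasure_eq_measure)
  qed simp
  have "rep_prob M = rep_prob N"
  proof (rule measure_eqI_generator_eq[where E = "Collect closed" and \<Omega> = UNIV and A = "\<lambda>_. UNIV"])
    show "Int_stable (Collect closed :: 'a set set)"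
      by (auto simp: Int_stable_def)
    show "sets (rep_prob M) = sigma_sets UNIV (Collect closed)"
      "sets (rep_prob N) = sigma_sets UNIV (Collect closed)"
      by (simp_all add: borel_eq_closed)
  qed (simp_all add: closed_eq)
  then show ?thesis
    by (simp add: rep_prob_inject)
qed

instance
proof
  fix M N R :: "'a borel_prob"
  show "dist M N = 0 \<longleftrightarrow> M = N"
  proof
    assume "M = N"
    have "0 \<le> dist M N"
      using bl_diff_le_dist[of "\<lambda>_. 0" M N] bl_norm_leI[of "\<lambda>_::'a. 0" 0 0] by simp
    moreover have "dist M N \<le> 0"
      using \<open>M = N\<close> by (intro dist_borel_prob_leI) simp
    ultimately show "dist M N = 0"
      by simp
  qed (rule dist_borel_prob_eq_0D)
  show "dist M N \<le> dist M R + dist N R"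
  proof (rule dist_borel_prob_leI)
    fix f :: "'a \<Rightarrow> real" assume "bl_norm f \<le> 1"
    from bl_diff_le_dist[OF this, of M R] bl_diff_le_dist[OF this, of N R]
    show "\<bar>integral\<^sup>L (rep_prob M) f - integral\<^sup>L (rep_prob N) f\<bar> \<le> dist M R + dist N R"
      by linarith
  qed
qed (simp_all add: uniformity_borel_prob_def open_borel_prob_def)

end


text \<open>Samples of size \<open>n\<close> are the restrictions of \<open>z :: nat \<Rightarrow> 'z\<close> to \<open>{..<n}\<close>. The sample size 0 has
  no empirical measure; below only \<open>n \<ge> 1\<close> is used.\<close>

definition empirical :: "nat \<Rightarrow> (nat \<Rightarrow> 'z::topological_space) \<Rightarrow> 'z borel_prob" where
  "empirical n z =
     Abs_prob (measure_of UNIV (sets borel) (\<lambda>A. (\<Sum>i<n. emeasure (return borel (z i)) A) / of_nat n))"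

lemma emeasure_empirical:
  assumes "n \<ge> 1" "A \<in> sets borel"
  shows "emeasure (rep_prob (empirical n z)) A = (\<Sum>i<n. emeasure (return borel (z i)) A) / of_nat n"
proof -
  let ?\<mu> = "\<lambda>A. (\<Sum>i<n. emeasure (return borel (z i)) A) / of_nat n"
  let ?M = "measure_of UNIV (sets borel) ?\<mu>"
  have em: "emeasure ?M B = ?\<mu> B" if "B \<in> sets borel" for B
  proof (rule emeasure_measure_of[OF refl])
    show "countably_additive (sets ?M) ?\<mu>"
    proof (rule countably_additiveI)
      fix F :: "nat \<Rightarrow> 'a set"
      assume F: "range F \<subseteq> sets ?M" "disjoint_family F"
      then have F': "range F \<subseteq> sets borel"
        using sets.sigma_sets_eq[of "borel :: 'a measure"] by simp
      have "(\<Sum>k. ?\<mu> (F k)) = (\<Sum>k. \<Sum>i<n. emeasure (return borel (z i)) (F k)) / of_nat n"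
        by (simp add: divide_ennreal_def)
      also have "(\<Sum>k. \<Sum>i<n. emeasure (return borel (z i)) (F k)) =
          (\<Sum>i<n. \<Sum>k. emeasure (return borel (z i)) (F k))"
        by (intro suminf_sum) auto
      also have "\<dots> = (\<Sum>i<n. emeasure (return borel (z i)) (\<Union>k. F k))"
        using F' F(2) by (intro sum.cong refl suminf_emeasure) auto
      finally show "(\<Sum>k. ?\<mu> (F k)) = ?\<mu> (\<Union>k. F k)" .
    qed
    show "B \<in> sets ?M"
      using that sets.sigma_sets_eq[of "borel :: 'a measure"] by simp
  qed (auto simp: positive_def)
  have "sets ?M = sets borel"
    using sets.sigma_sets_eq[of "borel :: 'a measure"] by simp
  moreover have "prob_space ?M"
  proof
    have "emeasure ?M UNIV = of_nat n / of_nat n"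
      by (subst em) simp_all
    also have "\<dots> = 1"
      using assms(1) by (intro ennreal_divide_self) (auto simp: of_nat_less_top less_top[symmetric])
    finally show "emeasure ?M (space ?M) = 1"
      by (simp add: space_measure_of_conv)
  qed
  ultimately have "rep_prob (empirical n z) = ?M"
    unfolding empirical_def by (intro Abs_prob_inverse) auto
  then show ?thesis
    using em assms(2) by simp
qed

text \<open>Laws of statistics are image measures of the product measure; \<open>distr\<close> is meaningful only for
  measurable maps, hence the measurability hypotheses of the two lemmas below.\<close>

definition sample_law ::
    "(nat \<Rightarrow> (nat \<Rightarrow> 'z::topological_space) \<Rightarrow> 'w::topological_space) \<Rightarrow> nat \<Rightarrow> 'z borel_prob \<Rightarrow> 'w borel_prob" where
  "sample_law Sn n P = Abs_prob (distr (\<Pi>\<^sub>M i\<in>{..<n}. rep_prob P) borel (Sn n))"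

definition bootstrap_law ::
    "(nat \<Rightarrow> (nat \<Rightarrow> 'z::topological_space) \<Rightarrow> 'w::metric_space) \<Rightarrow> nat \<Rightarrow> 'z borel_prob
      \<Rightarrow> 'w borel_prob borel_prob" where
  "bootstrap_law Sn n Q =
     Abs_prob (distr (\<Pi>\<^sub>M i\<in>{..<n}. rep_prob Q) borel (\<lambda>z. sample_law Sn n (empirical n z)))"

lemma rep_prob_Abs_distr:
  assumes "f \<in> measurable (\<Pi>\<^sub>M i\<in>{..<n}. rep_prob P) borel"
  shows "rep_prob (Abs_prob (distr (\<Pi>\<^sub>M i\<in>{..<n}. rep_prob P) borel f)) =
    distr (\<Pi>\<^sub>M i\<in>{..<n}. rep_prob P) borel f"
  using assms by (intro Abs_prob_inverse)
    (auto intro!: prob_space.prob_space_distr prob_space_PiM prob_space_rep_prob)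

lemma rep_prob_sample_law:
  assumes "Sn n \<in> measurable (\<Pi>\<^sub>M i\<in>{..<n}. rep_prob P) borel"
  shows "rep_prob (sample_law Sn n P) = distr (\<Pi>\<^sub>M i\<in>{..<n}. rep_prob P) borel (Sn n)"
  using rep_prob_Abs_distr[OF assms] by (simp add: sample_law_def)

lemma rep_prob_bootstrap_law:
  assumes "(\<lambda>z. sample_law Sn n (empirical n z)) \<in> measurable (\<Pi>\<^sub>M i\<in>{..<n}. rep_prob Q) borel"
  shows "rep_prob (bootstrap_law Sn n Q) =
    distr (\<Pi>\<^sub>M i\<in>{..<n}. rep_prob Q) borel (\<lambda>z. sample_law Sn n (empirical n z))"
  using rep_prob_Abs_distr[OF assms] by (simp add: bootstrap_law_def)

text \<open>The supremum is a real number because \<open>dist\<close> is bounded by 2 here, see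
  \<open>dist_borel_prob_le_2\<close>.\<close>

definition bootstrap_qualitatively_robust ::
    "(nat \<Rightarrow> (nat \<Rightarrow> 'z::metric_space) \<Rightarrow> 'w::metric_space) \<Rightarrow> 'z borel_prob \<Rightarrow> bool" where
  "bootstrap_qualitatively_robust Sn P \<longleftrightarrow>
     (\<forall>\<epsilon>>0. \<exists>\<delta>>0. \<exists>n\<^sub>0\<ge>1. \<forall>Q. dist Q P < \<delta> \<longrightarrow>
        (SUP n\<in>{n\<^sub>0..}. dist (bootstrap_law Sn n Q) (bootstrap_law Sn n P)) < \<epsilon>)"

end

theory Submission
  imports Defs
begin

text \<open>On a compact space the empirical measure \<open>R\<^sub>n\<close> converges to \<open>R\<close> in probability, uniformly in \<open>R\<close>:
  the bounded Lipschitz ball has finite nets in the supremum norm, and Hoeffding's inequality does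
  not depend on \<open>R\<close>. So for large \<open>n\<close> and all \<open>R\<close> near \<open>P\<close>, \<open>R\<^sub>n\<close> is near \<open>P\<close> with high probability,
  and continuity of \<open>S\<close> at \<open>P\<close> alone puts the law of \<open>S(R\<^sub>n)\<close> near the Dirac measure at \<open>S(P)\<close>.
  Applying this to the random measure \<open>R = Q\<^sub>n\<close>, the bootstrap laws at \<open>Q\<close> and at \<open>P\<close> are both near the
  Dirac measure at the Dirac measure at \<open>S(P)\<close>.\<close>

section \<open>Couplings and the bounded Lipschitz metric\<close>

text \<open>Test functions in the unit ball are 1-Lipschitz and bounded by 1, so their values at
  \<open>X\<close> and \<open>Y\<close> differ by at most \<open>\<eta>\<close> off \<open>A\<close>
  and by at most 2 on \<open>A\<close>. Integrating over the common space \<open>\<Omega>\<close>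
  gives the bound.\<close>

lemma dist_borel_prob_le_coupling:
  fixes X Y :: "'a \<Rightarrow> 'b::metric_space"
  assumes "prob_space \<Omega>"
    and [measurable]: "X \<in> borel_measurable \<Omega>" "Y \<in> borel_measurable \<Omega>"
    and M: "rep_prob M = distr \<Omega> borel X" and N: "rep_prob N = distr \<Omega> borel Y"
    and [measurable]: "A \<in> sets \<Omega>" and "0 \<le> \<eta>"
    and close: "\<And>\<omega>. \<omega> \<in> space \<Omega> \<Longrightarrow> \<omega> \<notin> A \<Longrightarrow> dist (X \<omega>) (Y \<omega>) \<le> \<eta>"
  shows "dist M N \<le> \<eta> + 2 * measure \<Omega> A"
proof (rule dist_borel_prob_leI)
  interpret prob_space \<Omega> by fact
  fix f :: "'b \<Rightarrow> real" assume f: "bl_norm f \<le> 1"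
  note bl = bl_norm_le_1D[OF f]
  have [measurable]: "f \<in> borel_measurable borel"
    using f by (rule bl_norm_measurable)
  have intX: "integrable \<Omega> (\<lambda>\<omega>. f (X \<omega>))" and intY: "integrable \<Omega> (\<lambda>\<omega>. f (Y \<omega>))"
    using bl(1) by (auto intro!: integrable_const_bound[of _ 1])
  have "\<bar>integral\<^sup>L (rep_prob M) f - integral\<^sup>L (rep_prob N) f\<bar> = \<bar>\<integral>\<omega>. f (X \<omega>) - f (Y \<omega>) \<partial>\<Omega>\<bar>"
    using intX intY by (simp add: M N integral_distr)
  also have "\<dots> \<le> (\<integral>\<omega>. \<bar>f (X \<omega>) - f (Y \<omega>)\<bar> \<partial>\<Omega>)"
    by (rule integral_abs_bound)
  also have "\<dots> \<le> (\<integral>\<omega>. \<eta> + 2 * indicator A \<omega> \<partial>\<Omega>)"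
  proof (rule integral_mono)
    fix \<omega> assume \<omega>: "\<omega> \<in> space \<Omega>"
    show "\<bar>f (X \<omega>) - f (Y \<omega>)\<bar> \<le> \<eta> + 2 * indicator A \<omega>"
    proof (cases "\<omega> \<in> A")
      case True
      then show ?thesis
        using bl(1)[of "X \<omega>"] bl(1)[of "Y \<omega>"] \<open>0 \<le> \<eta>\<close> by simp
    next
      case False
      then show ?thesis
        using bl(2)[of "X \<omega>" "Y \<omega>"] close[OF \<omega>] by simp
    qed
  qed (use intX intY in \<open>auto simp: less_top[symmetric]\<close>)
  also have "\<dots> = \<eta> + 2 * measure \<Omega> A"
    by (simp add: prob_space less_top[symmetric])
  finally show "\<bar>integral\<^sup>L (rep_prob M) f - integral\<^sup>L (rep_prob N) f\<bar> \<le> \<eta> + 2 * measure \<Omega> A" .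
qed

text \<open>On a finite space pointwise convergence is uniform, so the coupling bound applies with
  the empty exceptional set. The space will be that of a random index, or of a random tuple of
  indices.\<close>

lemma tendsto_borel_prob_finite_space:
  fixes X :: "nat \<Rightarrow> 'a \<Rightarrow> 'b::metric_space"
  assumes "prob_space \<Omega>" "finite (space \<Omega>)"
    and X: "\<And>k. X k \<in> borel_measurable \<Omega>" and Y: "Y \<in> borel_measurable \<Omega>"
    and M: "\<And>k. rep_prob (M k) = distr \<Omega> borel (X k)" and N: "rep_prob N = distr \<Omega> borel Y"
    and lim: "\<And>\<omega>. \<omega> \<in> space \<Omega> \<Longrightarrow> (\<lambda>k. X k \<omega>) \<longlonglongrightarrow> Y \<omega>"
  shows "M \<longlonglongrightarrow> N"
proof (rule tendstoI)
  fix e :: real assume "0 < e"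
  then have "\<forall>\<^sub>F k in sequentially. \<forall>\<omega>\<in>space \<Omega>. dist (X k \<omega>) (Y \<omega>) < e / 2"
    using lim \<open>finite (space \<Omega>)\<close>
    by (intro eventually_ball_finite ballI tendstoD) auto
  then show "\<forall>\<^sub>F k in sequentially. dist (M k) N < e"
  proof eventually_elim
    case (elim k)
    have "dist (M k) N \<le> e / 2 + 2 * measure \<Omega> {}"
      using elim \<open>0 < e\<close>
      by (intro dist_borel_prob_le_coupling[OF \<open>prob_space \<Omega>\<close> X Y M N]) (auto intro: less_imp_le)
    then show ?case
      using \<open>0 < e\<close> by simp
  qed
qed

section \<open>Measurability on finite powers of a compact space\<close>

lemma compact_UNIV_finite_valued_approx:
  fixes e :: real
  assumes "compact (UNIV :: 'z::metric_space set)" and "0 < e"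
  obtains c :: "'z::metric_space \<Rightarrow> 'z" and D where
    "finite D" "c \<in> borel \<rightarrow>\<^sub>M count_space D" "\<And>x. dist (c x) x < e"
proof -
  obtain D :: "'z set" where D: "finite D" "UNIV \<subseteq> (\<Union>x\<in>D. ball x e)"
    using assms by (auto simp: compact_eq_totally_bounded)
  obtain xs where xs: "set xs = D"
    using D(1) finite_list by blast
  \<comment> \<open>Taking the first net point within distance \<open>e\<close>, in the order of a
    fixed list, makes the choice of a nearby net point measurable.\<close>
  define l where "l x = (LEAST i. i < length xs \<and> dist (xs ! i) x < e)" for x
  have l: "l x < length xs \<and> dist (xs ! l x) x < e" for x
  proof -
    obtain d where "d \<in> D" "dist d x < e"
      using D(2)[THEN subsetD, of x] by auto
    then have "\<exists>i. i < length xs \<and> dist (xs ! i) x < e"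
      using xs by (metis in_set_conv_nth)
    then show ?thesis
      unfolding l_def by (rule LeastI_ex)
  qed
  have [measurable]: "Measurable.pred borel (\<lambda>x. dist y x < e)" for y :: 'z
  proof -
    have "{x. dist y x < e} = ball y e"
      by (auto simp: ball_def)
    then show ?thesis
      by (simp add: pred_def)
  qed
  have "l \<in> borel \<rightarrow>\<^sub>M count_space UNIV"
    unfolding l_def by measurable
  then have "l \<in> borel \<rightarrow>\<^sub>M count_space {..<length xs}"
    using l by (auto simp: measurable_count_space_eq2_countable)
  moreover have "(!) xs \<in> count_space {..<length xs} \<rightarrow>\<^sub>M count_space D"
    using xs by auto
  ultimately have "(\<lambda>x. xs ! l x) \<in> borel \<rightarrow>\<^sub>M count_space D"
    by (rule measurable_compose)
  then show thesis
    using that[of D "\<lambda>x. xs ! l x"] D(1) l by blast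
qed

text \<open>\<open>F\<close> is the pointwise limit of its values at discretised arguments, and each
  discretisation factors through a finite discrete space. Taking constant sequences in
  \<open>cont\<close> shows that \<open>F\<close> depends only on the coordinates in
  \<open>I\<close>.\<close>

lemma borel_measurable_PiM_sequentially_continuous:
  fixes F :: "('i \<Rightarrow> 'z::metric_space) \<Rightarrow> 'b::metric_space"
  assumes "compact (UNIV :: 'z set)" and "finite I"
    and cont: "\<And>u z. (\<And>i. i \<in> I \<Longrightarrow> (\<lambda>k. u k i) \<longlonglongrightarrow> z i) \<Longrightarrow> (\<lambda>k. F (u k)) \<longlonglongrightarrow> F z"
  shows "F \<in> borel_measurable (\<Pi>\<^sub>M i\<in>I. borel)"
proof -
  have "\<forall>k. \<exists>c D. finite D \<and> c \<in> borel \<rightarrow>\<^sub>M count_space D \<and>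
      (\<forall>x :: 'z. dist (c x) x < 1 / real (Suc k))"
  proof
    fix k
    have "0 < 1 / real (Suc k)"
      by simp
    then obtain c :: "'z \<Rightarrow> 'z" and D where "finite D" "c \<in> borel \<rightarrow>\<^sub>M count_space D"
      "\<And>x. dist (c x) x < 1 / real (Suc k)"
      by (rule compact_UNIV_finite_valued_approx[OF assms(1)]) (rule that)
    then show "\<exists>c D. finite D \<and> c \<in> borel \<rightarrow>\<^sub>M count_space D \<and>
        (\<forall>x :: 'z. dist (c x) x < 1 / real (Suc k))"
      by blast
  qed
  then obtain c :: "nat \<Rightarrow> 'z \<Rightarrow> 'z" and D where D: "\<And>k. finite (D k)"
    and c [measurable]: "\<And>k. c k \<in> borel \<rightarrow>\<^sub>M count_space (D k)"
    and close: "\<And>k x. dist (c k x) x < 1 / real (Suc k)"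
    unfolding choice_iff by blast
  show ?thesis
  proof (rule borel_measurable_LIMSEQ_metric)
    fix k
    have "(\<lambda>z. \<lambda>i\<in>I. c k (z i)) \<in> (\<Pi>\<^sub>M i\<in>I. borel) \<rightarrow>\<^sub>M (\<Pi>\<^sub>M i\<in>I. count_space (D k))"
      by measurable
    \<comment> \<open>A finite product of finite discrete spaces is discrete, so \<open>F\<close> is
      measurable on it without further argument.\<close>
    also have "(\<Pi>\<^sub>M i\<in>I. count_space (D k)) = count_space (I \<rightarrow>\<^sub>E D k)"
      using \<open>finite I\<close> D by (intro count_space_PiM_finite) (auto intro: countable_finite)
    finally show "(\<lambda>z. F (\<lambda>i\<in>I. c k (z i))) \<in> borel_measurable (\<Pi>\<^sub>M i\<in>I. borel)"
      by (rule measurable_compose) simp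
  next
    fix z :: "'i \<Rightarrow> 'z"
    have "(\<lambda>k. c k x) \<longlonglongrightarrow> x" for x
    proof (rule tendsto_dist_iff[THEN iffD2], rule tendsto_sandwich[OF _ _ tendsto_const])
      show "(\<lambda>k. 1 / real (Suc k)) \<longlonglongrightarrow> 0"
        by (rule LIMSEQ_Suc[OF lim_1_over_n])
    qed (use close in \<open>auto intro!: always_eventually less_imp_le\<close>)
    then show "(\<lambda>k. F (\<lambda>i\<in>I. c k (z i))) \<longlonglongrightarrow> F z"
      by (intro cont) simp
  qed
qed

section \<open>Empirical measures and laws of resamples\<close>

lemma measurable_PiM_rep_prob:
  "measurable (\<Pi>\<^sub>M i\<in>I. rep_prob P) N = measurable (\<Pi>\<^sub>M i\<in>I. borel) N"
  by (intro measurable_cong_sets sets_PiM_cong) auto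

text \<open>Reading \<open>z\<close> as a random variable of a uniform index realises all empirical
  measures of size \<open>n\<close> on one finite space, where they can be coupled.\<close>

lemma rep_prob_empirical:
  assumes "n \<ge> 1"
  shows "rep_prob (empirical n z) = distr (uniform_count_measure {..<n}) borel z"
proof (rule measure_eqI)
  fix A :: "'a set" assume "A \<in> sets (rep_prob (empirical n z))"
  then have A: "A \<in> sets borel"
    by simp
  have z: "z \<in> uniform_count_measure {..<n} \<rightarrow>\<^sub>M borel"
    by (simp add: measurable_cong_sets[OF sets_uniform_count_measure_count_space refl])
  have "(\<Sum>i<n. emeasure (return borel (z i)) A) = of_nat (card (z -` A \<inter> {..<n}))"
    using A by (simp add: indicator_def sum.If_cases Int_commute vimage_def)
  then show "emeasure (rep_prob (empirical n z)) A
      = emeasure (distr (uniform_count_measure {..<n}) borel z) A"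
    using assms A z
    by (simp add: emeasure_empirical emeasure_distr space_uniform_count_measure
        emeasure_uniform_count_measure ennreal_of_nat_eq_real_of_nat divide_ennreal)
qed simp

lemma integral_empirical:
  fixes f :: "'z::topological_space \<Rightarrow> real"
  assumes "n \<ge> 1" and "f \<in> borel_measurable borel"
  shows "integral\<^sup>L (rep_prob (empirical n z)) f = (\<Sum>i<n. f (z i)) / real n"
proof -
  have z: "z \<in> uniform_count_measure {..<n} \<rightarrow>\<^sub>M borel"
    by (simp add: measurable_cong_sets[OF sets_uniform_count_measure_count_space refl])
  show ?thesis
    using assms by (simp add: rep_prob_empirical integral_distr[OF z] integral_uniform_count_measure)
qed

text \<open>Both sides are laws of sample points at the same uniformly chosen index, and at each
  index the points converge.\<close>

lemma tendsto_empirical: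
  fixes u :: "nat \<Rightarrow> nat \<Rightarrow> 'z::metric_space"
  assumes "n \<ge> 1" and "\<And>i. i < n \<Longrightarrow> (\<lambda>k. u k i) \<longlonglongrightarrow> z i"
  shows "(\<lambda>k. empirical n (u k)) \<longlonglongrightarrow> empirical n z"
proof (rule tendsto_borel_prob_finite_space[where \<Omega> = "uniform_count_measure {..<n}"])
  show "prob_space (uniform_count_measure {..<n})"
    using assms(1) by (intro prob_space_uniform_count_measure) (auto simp: lessThan_empty_iff)
qed (use assms in \<open>auto simp: rep_prob_empirical space_uniform_count_measure
    measurable_cong_sets[OF sets_uniform_count_measure_count_space refl]\<close>)

text \<open>The bootstrap law at the empirical measure of \<open>z\<close> is the law of the statistic at the resample
  \<open>z \<circ> j\<close> for a uniformly distributed \<open>j\<close>; this makes its dependence on \<open>z\<close> explicit.\<close>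

lemma rep_prob_sample_law_empirical:
  assumes "n \<ge> 1" and Sn: "Sn n \<in> borel_measurable (\<Pi>\<^sub>M i\<in>{..<n}. borel)"
  shows "rep_prob (sample_law Sn n (empirical n z)) =
    distr (\<Pi>\<^sub>M i\<in>{..<n}. uniform_count_measure {..<n}) borel (\<lambda>j. Sn n (compose {..<n} z j))"
    and "(\<lambda>j. Sn n (compose {..<n} z j)) \<in>
      borel_measurable (\<Pi>\<^sub>M i\<in>{..<n}. uniform_count_measure {..<n})"
proof -
  let ?U = "uniform_count_measure {..<n}" and ?E = "rep_prob (empirical n z)"
  have U: "prob_space ?U"
    using assms(1) by (intro prob_space_uniform_count_measure) (auto simp: lessThan_empty_iff)
  have z: "z \<in> ?U \<rightarrow>\<^sub>M ?E"
    by (simp add: measurable_cong_sets[OF sets_uniform_count_measure_count_space sets_rep_prob])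
  have E: "distr ?U ?E z = ?E"
    unfolding rep_prob_empirical[OF assms(1)] by (rule distr_cong) simp_all
  \<comment> \<open>Drawing \<open>n\<close> independent indices and looking up their points yields
    an i.i.d. sample from the empirical measure.\<close>
  have prod: "distr (\<Pi>\<^sub>M i\<in>{..<n}. ?U) (\<Pi>\<^sub>M i\<in>{..<n}. ?E) (compose {..<n} z) = (\<Pi>\<^sub>M i\<in>{..<n}. ?E)"
    using distr_PiM_finite_prob_space'[of "{..<n}" "\<lambda>_. ?U" "\<lambda>_. ?E" z] U z
    by (simp add: E prob_space_rep_prob)
  have Sn': "Sn n \<in> borel_measurable (\<Pi>\<^sub>M i\<in>{..<n}. ?E)"
    using Sn by (simp add: measurable_PiM_rep_prob)
  have comp: "compose {..<n} z \<in> (\<Pi>\<^sub>M i\<in>{..<n}. ?U) \<rightarrow>\<^sub>M (\<Pi>\<^sub>M i\<in>{..<n}. ?E)"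
    unfolding compose_def using z by measurable
  show "(\<lambda>j. Sn n (compose {..<n} z j)) \<in> borel_measurable (\<Pi>\<^sub>M i\<in>{..<n}. ?U)"
    using comp Sn' by (rule measurable_compose)
  have "rep_prob (sample_law Sn n (empirical n z)) = distr (\<Pi>\<^sub>M i\<in>{..<n}. ?E) borel (Sn n)"
    using Sn' by (rule rep_prob_sample_law)
  also have "\<dots> = distr (\<Pi>\<^sub>M i\<in>{..<n}. ?U) borel (Sn n \<circ> compose {..<n} z)"
    by (subst prod[symmetric], rule distr_distr[OF Sn' comp])
  finally show "rep_prob (sample_law Sn n (empirical n z)) =
      distr (\<Pi>\<^sub>M i\<in>{..<n}. ?U) borel (\<lambda>j. Sn n (compose {..<n} z j))"
    by (simp add: comp_def)
qed

text \<open>This makes \<open>bootstrap_law\<close> a genuine image measure. The space of index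
  tuples is finite and does not depend on \<open>z\<close>, so continuity of the statistic at each
  resample carries over to the laws.\<close>

lemma borel_measurable_sample_law_empirical:
  fixes Sn :: "nat \<Rightarrow> (nat \<Rightarrow> 'z::metric_space) \<Rightarrow> 'w::metric_space"
  assumes "compact (UNIV :: 'z set)" and "n \<ge> 1"
    and cont: "\<And>u z. (\<And>i. i < n \<Longrightarrow> (\<lambda>k. u k i) \<longlonglongrightarrow> z i) \<Longrightarrow> (\<lambda>k. Sn n (u k)) \<longlonglongrightarrow> Sn n z"
  shows "(\<lambda>z. sample_law Sn n (empirical n z)) \<in> borel_measurable (\<Pi>\<^sub>M i\<in>{..<n}. borel)"
proof (rule borel_measurable_PiM_sequentially_continuous[OF assms(1)])
  fix u :: "nat \<Rightarrow> nat \<Rightarrow> 'z" and z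
  assume lim: "\<And>i. i \<in> {..<n} \<Longrightarrow> (\<lambda>k. u k i) \<longlonglongrightarrow> z i"
  have Sn: "Sn n \<in> borel_measurable (\<Pi>\<^sub>M i\<in>{..<n}. borel)"
    using assms by (intro borel_measurable_PiM_sequentially_continuous) auto
  let ?\<Omega> = "\<Pi>\<^sub>M i\<in>{..<n}. uniform_count_measure {..<n}"
  note law = rep_prob_sample_law_empirical[where n = n and Sn = Sn, OF \<open>n \<ge> 1\<close> Sn]
  show "(\<lambda>k. sample_law Sn n (empirical n (u k))) \<longlonglongrightarrow> sample_law Sn n (empirical n z)"
  proof (rule tendsto_borel_prob_finite_space[OF _ _ law(2) law(2) law(1) law(1)])
    show "prob_space ?\<Omega>"
      using \<open>n \<ge> 1\<close> by (intro prob_space_PiM prob_space_uniform_count_measure) (auto simp: lessThan_empty_iff)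
    show "finite (space ?\<Omega>)"
      by (auto simp: space_PiM space_uniform_count_measure intro!: finite_PiE)
    fix j assume "j \<in> space ?\<Omega>"
    then have "j i < n" if "i < n" for i
      using that by (auto simp: space_PiM space_uniform_count_measure)
    then show "(\<lambda>k. Sn n (compose {..<n} (u k) j)) \<longlonglongrightarrow> Sn n (compose {..<n} z j)"
      using lim by (intro cont) (simp add: compose_def)
  qed
qed simp

section \<open>Uniform convergence of empirical measures\<close>

text \<open>A form of the Arzela-Ascoli theorem: the Lipschitz bound reduces a function to its
  rounded values on a finite net of points, and boundedness by 1 leaves finitely many patterns of
  such values.\<close>

lemma bl_norm_ball_finite_net:
  assumes "compact (UNIV :: 'z::metric_space set)" and "0 < e"
  obtains G :: "('z::metric_space \<Rightarrow> real) set" where "finite G" "\<And>g. g \<in> G \<Longrightarrow> bl_norm g \<le> 1"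
    "\<And>f. bl_norm f \<le> 1 \<Longrightarrow> \<exists>g\<in>G. \<forall>x. \<bar>f x - g x\<bar> \<le> e"
proof -
  obtain D :: "'z set" where D: "finite D" "UNIV \<subseteq> (\<Union>x\<in>D. ball x (e / 3))"
    using assms compact_eq_totally_bounded[of "UNIV :: 'z set"]
    by (metis zero_less_divide_iff zero_less_numeral)
  define B where "B = {f :: 'z \<Rightarrow> real. bl_norm f \<le> 1}"
  \<comment> \<open>Two functions with the same values on \<open>D\<close> up to rounding differ by at most \<open>3 \<cdot> e / 3\<close> everywhere.\<close>
  define \<Phi> where "\<Phi> f = (\<lambda>d\<in>D. \<lfloor>f d / (e / 3)\<rfloor>)" for f :: "'z \<Rightarrow> real"
  have "\<Phi> ` B \<subseteq> D \<rightarrow>\<^sub>E {\<lfloor>-1 / (e / 3)\<rfloor>..\<lfloor>1 / (e / 3)\<rfloor>}"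
  proof (intro image_subsetI, unfold \<Phi>_def, intro restrict_PiE_iff[THEN iffD2] ballI)
    fix f d assume "f \<in> B"
    then have "\<bar>f d\<bar> \<le> 1"
      unfolding B_def using bl_norm_le_1D(1) by blast
    then have "-1 / (e / 3) \<le> f d / (e / 3)" "f d / (e / 3) \<le> 1 / (e / 3)"
      using \<open>0 < e\<close> by (intro divide_right_mono; linarith)+
    then show "\<lfloor>f d / (e / 3)\<rfloor> \<in> {\<lfloor>-1 / (e / 3)\<rfloor>..\<lfloor>1 / (e / 3)\<rfloor>}"
      unfolding atLeastAtMost_iff by (blast intro: floor_mono)
  qed
  then have "finite (\<Phi> ` B)"
    by (rule finite_subset) (intro finite_PiE D finite_atLeastAtMost_int)
  \<comment> \<open>The representatives of the patterns come from the ball itself, so the net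
    consists of functions to which the Lipschitz and integrability bounds apply as well.\<close>
  then obtain G where G: "G \<subseteq> B" "finite G" "\<Phi> ` B = \<Phi> ` G"
    using finite_subset_image[of "\<Phi> ` B" \<Phi> B] by auto
  show thesis
  proof
    fix f :: "'z \<Rightarrow> real" assume f: "bl_norm f \<le> 1"
    then have "\<Phi> f \<in> \<Phi> ` G"
      using G(3) by (auto simp: B_def)
    then obtain g where g: "g \<in> G" "\<Phi> f = \<Phi> g"
      by auto
    then have "bl_norm g \<le> 1"
      using G(1) by (auto simp: B_def)
    have "\<bar>f x - g x\<bar> \<le> e" for x
    proof -
      obtain d where d: "d \<in> D" "dist d x < e / 3"
        using D(2)[THEN subsetD, of x] by auto
      have "\<lfloor>f d / (e / 3)\<rfloor> = \<lfloor>g d / (e / 3)\<rfloor>"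
        using fun_cong[OF g(2), of d] d(1) by (simp add: \<Phi>_def)
      then have "\<bar>f d / (e / 3) - g d / (e / 3)\<bar> < 1"
        by linarith
      then have "\<bar>f d - g d\<bar> < e / 3"
        using \<open>0 < e\<close> by (simp add: diff_divide_distrib[symmetric] abs_divide pos_divide_less_eq
            del: divide_divide_eq_right)
      then show ?thesis
        using bl_norm_le_1D(2)[OF f, of d x] bl_norm_le_1D(2)[OF \<open>bl_norm g \<le> 1\<close>, of d x] d(2)
        by linarith
    qed
    then show "\<exists>g\<in>G. \<forall>x. \<bar>f x - g x\<bar> \<le> e"
      using g(1) by blast
  qed (use G in \<open>auto simp: B_def\<close>)
qed

text \<open>Independence means that the joint law is the product of the marginals. Here the joint
  map is the identity on the product space.\<close>

lemma indep_vars_PiM_components: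
  assumes "finite I" and "I \<noteq> {}" and M: "\<And>i. i \<in> I \<Longrightarrow> prob_space (M i)"
  shows "prob_space.indep_vars (PiM I M) M (\<lambda>i z. z i) I"
proof -
  interpret prob_space "PiM I M"
    using M by (rule prob_space_PiM)
  have "distr (PiM I M) (PiM I M) (\<lambda>z. \<lambda>i\<in>I. z i) = distr (PiM I M) (PiM I M) (\<lambda>z. z)"
    by (intro distr_cong) (auto simp: space_PiM)
  also have "\<dots> = PiM I M"
    by (rule distr_id)
  also have "\<dots> = (\<Pi>\<^sub>M i\<in>I. distr (PiM I M) (M i) (\<lambda>z. z i))"
    using assms by (intro PiM_cong refl) (simp add: distr_PiM_component)
  finally show ?thesis
    using \<open>I \<noteq> {}\<close> by (subst indep_vars_iff_distr_eq_PiM') simp_all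
qed

text \<open>Hoeffding's inequality for the independent variables \<open>g (z i)\<close>, with values
  in an interval of length 2 and deviation \<open>n t\<close> of the sum: the exponent is
  \<open>2 (n t)^2 / (4 n)\<close>. The bound is the same for every \<open>P\<close>.\<close>

lemma empirical_mean_concentration:
  fixes P :: "'z::metric_space borel_prob"
  assumes "n \<ge> 1" and g: "bl_norm g \<le> 1" and "0 \<le> t"
  shows "measure (\<Pi>\<^sub>M i\<in>{..<n}. rep_prob P)
      {z \<in> space (\<Pi>\<^sub>M i\<in>{..<n}. rep_prob P). t \<le> \<bar>(\<Sum>i<n. g (z i)) / real n - integral\<^sup>L (rep_prob P) g\<bar>}
    \<le> 2 * exp (- (real n * t\<^sup>2 / 2))"
proof -
  let ?M = "\<Pi>\<^sub>M i\<in>{..<n}. rep_prob P"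
  interpret prob_space ?M
    by (intro prob_space_PiM prob_space_rep_prob)
  have [measurable]: "g \<in> borel_measurable borel"
    using g by (rule bl_norm_measurable)
  have gP: "g \<in> borel_measurable (rep_prob P)"
    by measurable
  have comp: "(\<lambda>z. z i) \<in> ?M \<rightarrow>\<^sub>M rep_prob P" if "i < n" for i
    using that by (intro measurable_component_singleton) auto
  have law: "distr ?M (rep_prob P) (\<lambda>z. z i) = rep_prob P" if "i < n" for i
    using that by (intro distr_PiM_component) (auto intro: prob_space_rep_prob)
  have mean: "integral\<^sup>L ?M (\<lambda>z. g (z i)) = integral\<^sup>L (rep_prob P) g" if "i < n" for i
    using integral_distr[OF comp[OF that] gP] law[OF that] by simp
  interpret Hoeffding_ineq ?M "{..<n}" "\<lambda>i z. g (z i)" "\<lambda>_. -1" "\<lambda>_. 1"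
    "real n * integral\<^sup>L (rep_prob P) g"
  proof unfold_locales
    show "indep_vars (\<lambda>_. borel) (\<lambda>i z. g (z i)) {..<n}"
      using assms(1)
      by (intro indep_vars_compose2[OF indep_vars_PiM_components] prob_space_rep_prob gP)
        (auto simp: lessThan_empty_iff)
    show "AE z in ?M. g (z i) \<in> {-1..1}" for i
      using bl_norm_le_1D(1)[OF g] by (auto simp: abs_le_iff minus_le_iff)
    show "real n * integral\<^sup>L (rep_prob P) g \<equiv> \<Sum>i<n. expectation (\<lambda>z. g (z i))"
      by (simp add: mean)
  qed simp
  have "(t \<le> \<bar>(\<Sum>i<n. g (z i)) / real n - integral\<^sup>L (rep_prob P) g\<bar>) \<longleftrightarrow>
      (real n * t \<le> \<bar>(\<Sum>i<n. g (z i)) - real n * integral\<^sup>L (rep_prob P) g\<bar>)" for z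
  proof -
    have "(\<Sum>i<n. g (z i)) - real n * integral\<^sup>L (rep_prob P) g =
        real n * ((\<Sum>i<n. g (z i)) / real n - integral\<^sup>L (rep_prob P) g)"
      using assms(1) by (simp add: field_simps)
    then show ?thesis
      using assms(1) by (simp add: abs_mult)
  qed
  then show ?thesis
    using Hoeffding_ineq_abs_ge[of "real n * t"] assms
    by (simp add: power_mult_distrib power2_eq_square ac_simps)
qed

text \<open>A union bound over a finite net of test functions. The net depends on
  \<open>\<rho>\<close> but not on \<open>P\<close>, which makes \<open>n0\<close> uniform in
  \<open>P\<close>; this is essential because the measure being resampled is itself random.\<close>

lemma uniform_Glivenko_Cantelli:
  fixes \<rho> \<eta> :: real
  assumes comp: "compact (UNIV :: 'z::metric_space set)" and "0 < \<rho>" and "0 < \<eta>"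
  obtains n0 where "n0 \<ge> 1" "\<And>n (P :: 'z borel_prob). n \<ge> n0 \<Longrightarrow>
    measure (\<Pi>\<^sub>M i\<in>{..<n}. rep_prob P)
      {z \<in> space (\<Pi>\<^sub>M i\<in>{..<n}. rep_prob P). \<rho> \<le> dist (empirical n z) P} \<le> \<eta>"
proof -
  obtain G :: "('z \<Rightarrow> real) set" where G: "finite G" "\<And>g. g \<in> G \<Longrightarrow> bl_norm g \<le> 1"
    and net: "\<And>f. bl_norm f \<le> 1 \<Longrightarrow> \<exists>g\<in>G. \<forall>x. \<bar>f x - g x\<bar> \<le> \<rho> / 4"
    using bl_norm_ball_finite_net[OF comp, of "\<rho> / 4"] \<open>0 < \<rho>\<close> by auto
  \<comment> \<open>Replacing a test function by its net approximant costs \<open>t\<close> under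
    each of the two measures, and the deviation on the net costs another \<open>t\<close>; the total
    \<open>3 * t\<close> stays below \<open>\<rho>\<close>.\<close>
  define t where "t = \<rho> / 4"
  have "0 < t"
    using \<open>0 < \<rho>\<close> by (simp add: t_def)
  have "(\<lambda>n. real (card G) * (2 * exp (- (real n * t\<^sup>2 / 2)))) \<longlonglongrightarrow> 0"
    using \<open>0 < t\<close> by real_asymp
  then have "\<forall>\<^sub>F n in sequentially. real (card G) * (2 * exp (- (real n * t\<^sup>2 / 2))) < \<eta>"
    using \<open>0 < \<eta>\<close> by (rule order_tendstoD)
  then obtain n1 where n1: "\<And>n. n \<ge> n1 \<Longrightarrow> real (card G) * (2 * exp (- (real n * t\<^sup>2 / 2))) < \<eta>"
    by (auto simp: eventually_sequentially)
  show thesis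
  proof
    fix n and P :: "'z borel_prob" assume n: "max 1 n1 \<le> n"
    then have "n \<ge> 1"
      by simp
    let ?M = "\<Pi>\<^sub>M i\<in>{..<n}. rep_prob P"
    interpret prob_space ?M
      by (intro prob_space_PiM prob_space_rep_prob)
    define A where "A g = {z \<in> space ?M.
      t \<le> \<bar>(\<Sum>i<n. g (z i)) / real n - integral\<^sup>L (rep_prob P) g\<bar>}" for g
    have A: "A g \<in> sets ?M" if "g \<in> G" for g
    proof -
      have [measurable]: "g \<in> borel_measurable borel"
        using G(2)[OF that] by (rule bl_norm_measurable)
      show ?thesis
        unfolding A_def by measurable
    qed
    have "{z \<in> space ?M. \<rho> \<le> dist (empirical n z) P} \<subseteq> (\<Union>g\<in>G. A g)"
    proof (rule ccontr)
      assume "\<not> ?thesis"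
      then obtain z where "\<rho> \<le> dist (empirical n z) P"
        and z: "\<And>g. g \<in> G \<Longrightarrow> \<bar>(\<Sum>i<n. g (z i)) / real n - integral\<^sup>L (rep_prob P) g\<bar> < t"
        unfolding A_def by force
      have "dist (empirical n z) P \<le> 3 * t"
      proof (rule dist_borel_prob_leI)
        fix f :: "'z \<Rightarrow> real" assume f: "bl_norm f \<le> 1"
        then obtain g where g: "g \<in> G" "\<And>x. \<bar>f x - g x\<bar> \<le> t"
          using net unfolding t_def by blast
        have close: "\<bar>integral\<^sup>L (rep_prob R) f - integral\<^sup>L (rep_prob R) g\<bar> \<le> t" for R
        proof -
          interpret R: prob_space "rep_prob R"
            by (rule prob_space_rep_prob)
          note int = bl_norm_integrable(1)[OF f, of R] bl_norm_integrable(1)[OF G(2)[OF g(1)], of R]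
          have "\<bar>integral\<^sup>L (rep_prob R) f - integral\<^sup>L (rep_prob R) g\<bar>
              = \<bar>\<integral>x. f x - g x \<partial>rep_prob R\<bar>"
            using int by simp
          also have "\<dots> \<le> (\<integral>x. \<bar>f x - g x\<bar> \<partial>rep_prob R)"
            by (rule integral_abs_bound)
          also have "\<dots> \<le> (\<integral>x. t \<partial>rep_prob R)"
            using int g(2) by (intro integral_mono) auto
          finally show ?thesis
            by (simp add: R.prob_space[simplified])
        qed
        have "\<bar>integral\<^sup>L (rep_prob (empirical n z)) g - integral\<^sup>L (rep_prob P) g\<bar> < t"
          using z[OF g(1)] integral_empirical[OF \<open>n \<ge> 1\<close> bl_norm_measurable[OF G(2)[OF g(1)]], of z]
          by simp
        then show "\<bar>integral\<^sup>L (rep_prob (empirical n z)) f - integral\<^sup>L (rep_prob P) f\<bar> \<le> 3 * t"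
          using close[of "empirical n z"] close[of P] by linarith
      qed
      then show False
        using \<open>\<rho> \<le> dist (empirical n z) P\<close> \<open>0 < \<rho>\<close> by (simp add: t_def)
    qed
    then have "prob {z \<in> space ?M. \<rho> \<le> dist (empirical n z) P} \<le> prob (\<Union>g\<in>G. A g)"
      using A G(1) by (intro finite_measure_mono) auto
    also have "\<dots> \<le> (\<Sum>g\<in>G. prob (A g))"
      using A G(1) by (intro finite_measure_subadditive_finite) auto
    also have "\<dots> \<le> (\<Sum>g\<in>G. 2 * exp (- (real n * t\<^sup>2 / 2)))"
      unfolding A_def using G(2) \<open>n \<ge> 1\<close> \<open>0 < t\<close>
      by (intro sum_mono empirical_mean_concentration) auto
    also have "\<dots> \<le> \<eta>"
      using n1[of n] n by simp
    finally show "prob {z \<in> space ?M. \<rho> \<le> dist (empirical n z) P} \<le> \<eta>" .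
  qed simp
qed

section \<open>Concentration near Dirac measures and robustness\<close>

lemma rep_prob_Abs_prob_return:
  "rep_prob (Abs_prob (return borel w)) = return borel w"
  by (intro Abs_prob_inverse) (auto intro: prob_space_return)

text \<open>Couple \<open>X\<close> with the constant \<open>w\<close>. Unless the empirical measure
  is \<open>\<rho>\<close>-far from \<open>R\<close>, it is within \<open>r + \<rho>\<close> of
  \<open>P\<close>, where \<open>X\<close> is close to \<open>w\<close>. A general target of
  \<open>X\<close> lets the lemma serve for the statistic and for its random law alike.\<close>

lemma law_near_dirac:
  fixes X :: "(nat \<Rightarrow> 'z::metric_space) \<Rightarrow> 'b::metric_space"
  assumes "compact (UNIV :: 'z set)" and "n \<ge> 1"
    and X: "X \<in> borel_measurable (\<Pi>\<^sub>M i\<in>{..<n}. borel)"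
    and N: "rep_prob N = distr (\<Pi>\<^sub>M i\<in>{..<n}. rep_prob R) borel X"
    and "0 \<le> \<eta>" and "dist R P \<le> r"
    and close: "\<And>z. dist (empirical n z) P < r + \<rho> \<Longrightarrow> dist (X z) w \<le> \<eta>"
    and small: "measure (\<Pi>\<^sub>M i\<in>{..<n}. rep_prob R)
      {z \<in> space (\<Pi>\<^sub>M i\<in>{..<n}. rep_prob R). \<rho> \<le> dist (empirical n z) R} \<le> \<beta>"
  shows "dist N (Abs_prob (return borel w)) \<le> \<eta> + 2 * \<beta>"
proof -
  let ?M = "\<Pi>\<^sub>M i\<in>{..<n}. rep_prob R"
  let ?A = "{z \<in> space ?M. \<rho> \<le> dist (empirical n z) R}"
  interpret prob_space ?M
    by (intro prob_space_PiM prob_space_rep_prob)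
  \<comment> \<open>Continuity of the empirical measure in the sample makes the exceptional event
    \<open>?A\<close> measurable.\<close>
  have "(\<lambda>z. dist (empirical n z) R) \<in> borel_measurable (\<Pi>\<^sub>M i\<in>{..<n}. borel)"
    using \<open>n \<ge> 1\<close>
    by (intro borel_measurable_PiM_sequentially_continuous[OF assms(1)] tendsto_dist
        tendsto_empirical) auto
  then have [measurable]: "(\<lambda>z. dist (empirical n z) R) \<in> borel_measurable ?M"
    by (simp add: measurable_PiM_rep_prob)
  have "dist N (Abs_prob (return borel w)) \<le> \<eta> + 2 * prob ?A"
  proof (rule dist_borel_prob_le_coupling[OF prob_space_axioms _ _ N])
    show "rep_prob (Abs_prob (return borel w)) = distr ?M borel (\<lambda>_. w)"
      by (simp add: rep_prob_Abs_prob_return distr_const)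
    fix z assume "z \<in> space ?M" "z \<notin> ?A"
    then have "dist (empirical n z) R < \<rho>"
      by auto
    then have "dist (empirical n z) P < r + \<rho>"
      using \<open>dist R P \<le> r\<close> dist_triangle[of "empirical n z" P R] by linarith
    then show "dist (X z) w \<le> \<eta>"
      by (rule close)
  qed (use X \<open>0 \<le> \<eta>\<close> in \<open>auto simp: measurable_PiM_rep_prob\<close>)
  then show ?thesis
    using small by linarith
qed

lemma bootstrap_law_near_dirac:
  fixes S :: "'z::metric_space borel_prob \<Rightarrow> 'w::metric_space"
  assumes comp: "compact (UNIV :: 'z set)" and cont: "continuous_on UNIV S" and "0 < \<epsilon>"
  obtains \<delta> n0 where "0 < \<delta>" "n0 \<ge> 1"
    "\<And>n Q. n \<ge> n0 \<Longrightarrow> dist Q P < \<delta> \<Longrightarrow>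
      dist (bootstrap_law (\<lambda>n z. S (empirical n z)) n Q)
        (Abs_prob (return borel (Abs_prob (return borel (S P))))) \<le> \<epsilon>"
proof -
  let ?Sn = "\<lambda>n z. S (empirical n z)"
  \<comment> \<open>The inner law costs \<open>\<eta> + 2 * \<eta>\<close>, and the exceptional
    event of the outer sample adds \<open>2 * \<eta>\<close>.\<close>
  define \<eta> where "\<eta> = \<epsilon> / 5"
  have "0 < \<eta>"
    using \<open>0 < \<epsilon>\<close> by (simp add: \<eta>_def)
  obtain d where "0 < d" and d: "\<And>R. dist R P < d \<Longrightarrow> dist (S R) (S P) < \<eta>"
    using cont \<open>0 < \<eta>\<close> unfolding continuous_on_iff by (metis UNIV_I)
  \<comment> \<open>Three distances add up to at most \<open>d\<close>: from \<open>P\<close> to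
    \<open>Q\<close>, from \<open>Q\<close> to its empirical measure, and from there to the
    empirical measure of the resample.\<close>
  define \<rho> where "\<rho> = d / 3"
  have "0 < \<rho>"
    using \<open>0 < d\<close> by (simp add: \<rho>_def)
  obtain n0 where "n0 \<ge> 1" and n0: "\<And>n (R :: 'z borel_prob). n \<ge> n0 \<Longrightarrow>
    measure (\<Pi>\<^sub>M i\<in>{..<n}. rep_prob R)
      {z \<in> space (\<Pi>\<^sub>M i\<in>{..<n}. rep_prob R). \<rho> \<le> dist (empirical n z) R} \<le> \<eta>"
    using uniform_Glivenko_Cantelli[OF comp \<open>0 < \<rho>\<close> \<open>0 < \<eta>\<close>] by blast
  show thesis
  proof
    fix n and Q :: "'z borel_prob" assume n: "n \<ge> n0" and Q: "dist Q P < \<rho>"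
    then have "n \<ge> 1"
      using \<open>n0 \<ge> 1\<close> by simp
    have lim: "(\<lambda>k. ?Sn n (u k)) \<longlonglongrightarrow> ?Sn n z"
      if "\<And>i. i < n \<Longrightarrow> (\<lambda>k. u k i) \<longlonglongrightarrow> z i" for u z
      using continuous_on_tendsto_compose[OF cont tendsto_empirical[OF \<open>n \<ge> 1\<close> that]] by simp
    have Sn: "?Sn n \<in> borel_measurable (\<Pi>\<^sub>M i\<in>{..<n}. borel)"
      by (intro borel_measurable_PiM_sequentially_continuous[OF comp] lim) auto
    have boot: "(\<lambda>z. sample_law ?Sn n (empirical n z)) \<in> borel_measurable (\<Pi>\<^sub>M i\<in>{..<n}. borel)"
      by (intro borel_measurable_sample_law_empirical[OF comp \<open>n \<ge> 1\<close>] lim)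
    \<comment> \<open>\<open>R\<close> stands for the empirical measure of the sample from
      \<open>Q\<close>; one \<open>\<rho>\<close> is spent on \<open>Q\<close> and one on the
      sampling.\<close>
    have inner: "dist (sample_law ?Sn n R) (Abs_prob (return borel (S P))) \<le> \<eta> + 2 * \<eta>"
      if "dist R P < 2 * \<rho>" for R
    proof (rule law_near_dirac[OF comp \<open>n \<ge> 1\<close> Sn, where P = P and r = "2 * \<rho>" and \<rho> = \<rho>])
      show "rep_prob (sample_law ?Sn n R) = distr (\<Pi>\<^sub>M i\<in>{..<n}. rep_prob R) borel (?Sn n)"
        using Sn by (intro rep_prob_sample_law) (simp add: measurable_PiM_rep_prob)
      show "dist (?Sn n z) (S P) \<le> \<eta>" if "dist (empirical n z) P < 2 * \<rho> + \<rho>" for z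
        using d[of "empirical n z"] that by (simp add: \<rho>_def)
    qed (use that n0[OF n] \<open>0 < \<eta>\<close> in auto)
    \<comment> \<open>Second application, one level up: the random variable is now the law of the
      resampled statistic, and \<open>inner\<close> supplies its closeness to the Dirac measure at
      \<open>S P\<close>.\<close>
    have "dist (bootstrap_law ?Sn n Q) (Abs_prob (return borel (Abs_prob (return borel (S P)))))
        \<le> (\<eta> + 2 * \<eta>) + 2 * \<eta>"
    proof (rule law_near_dirac[OF comp \<open>n \<ge> 1\<close> boot, where P = P and r = \<rho> and \<rho> = \<rho>])
      show "rep_prob (bootstrap_law ?Sn n Q) =
          distr (\<Pi>\<^sub>M i\<in>{..<n}. rep_prob Q) borel (\<lambda>z. sample_law ?Sn n (empirical n z))"
        using boot by (intro rep_prob_bootstrap_law) (simp add: measurable_PiM_rep_prob)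
    qed (use Q inner n0[OF n] \<open>0 < \<eta>\<close> in auto)
    then show "dist (bootstrap_law ?Sn n Q)
        (Abs_prob (return borel (Abs_prob (return borel (S P))))) \<le> \<epsilon>"
      by (simp add: \<eta>_def)
  qed (use \<open>0 < \<rho>\<close> \<open>n0 \<ge> 1\<close> in auto)
qed

theorem corollary4:
  fixes S :: "'z::metric_space borel_prob \<Rightarrow> 'w::polish_space"
  assumes "compact (UNIV :: 'z set)"
    and "continuous_on UNIV S"
  shows "\<forall>P. bootstrap_qualitatively_robust (\<lambda>n z. S (empirical n z)) P"
  unfolding bootstrap_qualitatively_robust_def
proof (intro allI impI)
  fix P :: "'z borel_prob" and \<epsilon> :: real assume "0 < \<epsilon>"
  let ?B = "bootstrap_law (\<lambda>n z. S (empirical n z))"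
  let ?\<Delta> = "Abs_prob (return borel (Abs_prob (return borel (S P))))"
  \<comment> \<open>Two distances of \<open>\<epsilon> / 4\<close> to \<open>?\<Delta>\<close> give
    \<open>\<epsilon> / 2\<close>, which leaves room for a strict inequality after taking the
    supremum.\<close>
  obtain \<delta> n0 where "0 < \<delta>" "n0 \<ge> 1"
    and near: "\<And>n Q. n \<ge> n0 \<Longrightarrow> dist Q P < \<delta> \<Longrightarrow> dist (?B n Q) ?\<Delta> \<le> \<epsilon> / 4"
    using bootstrap_law_near_dirac[OF assms, of "\<epsilon> / 4" P] \<open>0 < \<epsilon>\<close> by auto
  have "(SUP n\<in>{n0..}. dist (?B n Q) (?B n P)) < \<epsilon>" if "dist Q P < \<delta>" for Q
  proof -
    have "dist (?B n Q) (?B n P) \<le> \<epsilon> / 2" if n: "n \<ge> n0" for n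
      using near[OF n \<open>dist Q P < \<delta>\<close>] near[OF n, of P] \<open>0 < \<delta>\<close>
        dist_triangle2[of "?B n Q" "?B n P" ?\<Delta>]
      by simp
    then have "(SUP n\<in>{n0..}. dist (?B n Q) (?B n P)) \<le> \<epsilon> / 2"
      by (intro cSUP_least) auto
    then show ?thesis
      using \<open>0 < \<epsilon>\<close> by simp
  qed
  then show "\<exists>\<delta>>0. \<exists>n\<^sub>0\<ge>1. \<forall>Q. dist Q P < \<delta> \<longrightarrow> (SUP n\<in>{n\<^sub>0..}. dist (?B n Q) (?B n P)) < \<epsilon>"
    using \<open>0 < \<delta>\<close> \<open>n0 \<ge> 1\<close> by blast
qed

end
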